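(* Let $S$ be a $*$-monoid and let $a\in S$. Then the following conditions are equivalent: (i) $a$ is core invertible. (ii) $a$ is group invertible and has a $\{1,3\}$-inverse. (iii) $a$ is $a$-core invertible. (iv) There exists some $x\in S$ such that $a^2x^2=x$, $xa^3=a$ and $(a^2x)^*=a^2x$. In this case, writing $a^{c}$ for the core inverse of $a$, $a_a^{\#}$ for the $a$-core inverse of $a$, and $a^\#$ for the group inverse of $a$, one has $a^{c}=a\,a_a^{\#}$ and $a_a^{\#}=a^\#a^{c}$.
   Context: A $*$-monoid is a semigroup $S$ with identity $1$ and a map $*$ satisfying $(x^* )^*=x$ and $(xy)^*=y^*x^*$ for all $x,y\in S$. For $a,w\in S$, $a$ is $w$-core invertible if there exists $x\in S$ with $awx^2=x$, $xawa=a$ and $(awx)^*=awx$. Such an $x$ is called a $w$-core inverse of $a$; it is unique if it exists and is denoted here by $a_w^{\#}$. The case $w=1$ is the core inverse: $a$ is core invertible if there is $x\in S$ with $ax^2=x$, $xa^2=a$, $(ax)^*=ax$; this unique $x$ is the core inverse of $a$. The group inverse $a^\#$ of $a\in S$ is the (unique, if it exists) $x\in S$ with $ax=xa$, $xax=x$, $a=a^2x$. A $\{1,3\}$-inverse of $a$ is an $x\in S$ with $axa=a$ and $(ax)^*=ax$. *)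

theory Defs
  imports Main
begin

class star_monoid = monoid_mult +
  fixes star :: "'a \<Rightarrow> 'a"  ("_\<^sup>\<star>" [1000] 999)
  assumes star_star: "(x\<^sup>\<star>)\<^sup>\<star> = x"
    and star_mult: "(x * y)\<^sup>\<star> = y\<^sup>\<star> * x\<^sup>\<star>"

definition is_w_core_inverse :: "'a::star_monoid \<Rightarrow> 'a \<Rightarrow> 'a \<Rightarrow> bool" where
  "is_w_core_inverse w a x \<longleftrightarrow>
     a * w * x ^ 2 = x \<and> x * a * w * a = a \<and> (a * w * x)\<^sup>\<star> = a * w * x"

definition w_core_invertible :: "'a::star_monoid \<Rightarrow> 'a \<Rightarrow> bool" where
  "w_core_invertible w a \<longleftrightarrow> (\<exists>x. is_w_core_inverse w a x)"

definition is_core_inverse :: "'a::star_monoid \<Rightarrow> 'a \<Rightarrow> bool" where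
  "is_core_inverse a x \<longleftrightarrow>
     a * x ^ 2 = x \<and> x * a ^ 2 = a \<and> (a * x)\<^sup>\<star> = a * x"

definition core_invertible :: "'a::star_monoid \<Rightarrow> bool" where
  "core_invertible a \<longleftrightarrow> (\<exists>x. is_core_inverse a x)"

definition is_group_inverse :: "'a::monoid_mult \<Rightarrow> 'a \<Rightarrow> bool" where
  "is_group_inverse a x \<longleftrightarrow> a * x = x * a \<and> x * a * x = x \<and> a = a ^ 2 * x"

definition group_invertible :: "'a::monoid_mult \<Rightarrow> bool" where
  "group_invertible a \<longleftrightarrow> (\<exists>x. is_group_inverse a x)"

definition is_one_three_inverse :: "'a::star_monoid \<Rightarrow> 'a \<Rightarrow> bool" where
  "is_one_three_inverse a x \<longleftrightarrow> a * x * a = a \<and> (a * x)\<^sup>\<star> = a * x"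

text \<open>The functions below are meaningful only where the respective inverse exists;
  uniqueness is established in the lemmas that follow.\<close>

definition w_core_inverse :: "'a::star_monoid \<Rightarrow> 'a \<Rightarrow> 'a" where
  "w_core_inverse w a = (THE x. is_w_core_inverse w a x)"

definition core_inverse :: "'a::star_monoid \<Rightarrow> 'a" where
  "core_inverse a = (THE x. is_core_inverse a x)"

definition group_inverse :: "'a::monoid_mult \<Rightarrow> 'a" where
  "group_inverse a = (THE x. is_group_inverse a x)"

lemma is_core_inverse_iff: "is_core_inverse a x \<longleftrightarrow> is_w_core_inverse 1 a x"
  by (simp add: is_core_inverse_def is_w_core_inverse_def power2_eq_square mult.assoc)

lemma is_w_core_inverse_unique:
  assumes "is_w_core_inverse w a x" "is_w_core_inverse w a y"
  shows "x = y"
proof -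
  have absorb: "u * (a * w * v) = v"
    if "is_w_core_inverse w a u" "is_w_core_inverse w a v" for u v
  proof -
    have v: "a * w * v ^ 2 = v" and u: "u * a * w * a = a"
      using that unfolding is_w_core_inverse_def by blast+
    have "u * (a * w * v) = u * (a * w * (a * w * v ^ 2))" by (simp only: v)
    also have "\<dots> = (u * a * w * a) * w * v ^ 2" by (simp only: mult.assoc)
    finally show ?thesis by (simp only: u v)
  qed
  have fix_a: "a * w * u * a = a" if "is_w_core_inverse w a u" for u
  proof -
    have v: "a * w * u ^ 2 = u" and u: "u * a * w * a = a"
      using that unfolding is_w_core_inverse_def by blast+
    have "a * w * u * a = a * w * u * (u * a * w * a)" by (simp only: u)
    also have "\<dots> = (a * w * u ^ 2) * a * w * a" by (simp only: mult.assoc power2_eq_square)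
    finally show ?thesis by (simp only: u v)
  qed
  define P Q where "P = a * w * x" and "Q = a * w * y"
  have "P\<^sup>\<star> = P" "Q\<^sup>\<star> = Q"
    using assms unfolding is_w_core_inverse_def P_def Q_def by blast+
  moreover have PQ: "P * Q = Q"
    unfolding P_def Q_def using fix_a[OF assms(1)] by (simp only: flip: mult.assoc)
  moreover have QP: "Q * P = P"
    unfolding P_def Q_def using fix_a[OF assms(2)] by (simp only: flip: mult.assoc)
  ultimately have "P = Q" using star_mult[of Q P] by simp
  have "x = x * P" using absorb[OF assms(1,1)] by (simp only: P_def)
  also have "\<dots> = x * Q" by (simp only: \<open>P = Q\<close>)
  also have "\<dots> = y" using absorb[OF assms] by (simp only: Q_def)
  finally show ?thesis .
qed

lemma is_core_inverse_unique:
  "is_core_inverse a x \<Longrightarrow> is_core_inverse a y \<Longrightarrow> x = y"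
  unfolding is_core_inverse_iff by (rule is_w_core_inverse_unique)

lemma is_group_inverse_unique:
  assumes "is_group_inverse a x" "is_group_inverse a y"
  shows "x = y"
proof -
  have x: "a * x = x * a" "x * a * x = x" "a = a * a * x"
    and y: "a * y = y * a" "y * a * y = y" "a = a * a * y"
    using assms unfolding is_group_inverse_def power2_eq_square by blast+
  have "a * x * a = a * a * x" "a * y * a = a * a * y"
    unfolding mult.assoc by (simp_all only: x(1) y(1))
  then have axa: "a * x * a = a" "a * y * a = a"
    unfolding x(3)[symmetric] y(3)[symmetric] .
  have "a * x = (a * y * a) * x" by (simp only: axa(2))
  also have "\<dots> = (y * a) * (x * a)" unfolding y(1) x(1)[symmetric] by (simp only: mult.assoc)
  also have "\<dots> = y * (a * x * a)" by (simp only: mult.assoc)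
  finally have e: "a * x = a * y" by (simp only: axa(1) y(1))
  have "x = x * a * x" by (simp only: x(2))
  also have "\<dots> = x * (a * x)" by (rule mult.assoc)
  also have "\<dots> = x * (a * y)" by (simp only: e)
  also have "\<dots> = x * a * y" by (rule mult.assoc[symmetric])
  also have "\<dots> = y * a * y" by (simp only: e y(1) x(1)[symmetric])
  also have "\<dots> = y" by (rule y(2))
  finally show ?thesis .
qed

end

theory Submission
  imports Defs
begin

text \<open>
  A core inverse \<open>x\<close> of \<open>a\<close> is itself a \<open>{1,3}\<close>-inverse of \<open>a\<close>, and \<open>x\<^sup>2 a\<close> is the group
  inverse. Conversely, a group inverse \<open>g\<close> and a \<open>{1,3}\<close>-inverse \<open>y\<close> yield the core inverse
  \<open>c = g a y\<close> and the \<open>a\<close>-core inverse \<open>g c\<close>; the key identity is \<open>a y g = g\<close>. If \<open>z\<close> is an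
  \<open>a\<close>-core inverse of \<open>a\<close>, then \<open>u = z a\<close> satisfies \<open>a = a\<^sup>2 u = u a\<^sup>2\<close> and so commutes with
  \<open>a\<close>, which makes \<open>a z\<close> a core inverse. Uniqueness turns these constructions into the two
  formulas.
\<close>

text \<open>Expanding the last factor of \<open>a * x * a\<close> as \<open>x * (a * a)\<close>
  exposes \<open>a * (x * x)\<close>, which collapses to \<open>x\<close>.\<close>

lemma is_core_inverse_imp_one_three:
  assumes "is_core_inverse a x"
  shows "is_one_three_inverse a x"
proof -
  have x: "a * (x * x) = x" "x * (a * a) = a" "(a * x)\<^sup>\<star> = a * x"
    using assms unfolding is_core_inverse_def power2_eq_square by blast+
  have "a * x * a = a * x * (x * (a * a))" by (simp only: x(2))
  also have "\<dots> = (a * (x * x)) * (a * a)" by (simp only: mult.assoc)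
  finally show ?thesis unfolding is_one_three_inverse_def by (simp only: x)
qed

text \<open>Multiplying \<open>x\<^sup>2 * a\<close> by \<open>a\<close> on either side gives the
  same element \<open>x * a\<close>, so commutation is immediate; the other two laws reduce to
  \<open>x * a * x = x\<close> and \<open>a * x * a = a\<close>.\<close>

lemma is_core_inverse_imp_group:
  assumes "is_core_inverse a x"
  shows "is_group_inverse a (x\<^sup>2 * a)"
proof -
  have x: "a * (x * x) = x" "x * (a * a) = a"
    using assms unfolding is_core_inverse_def power2_eq_square by blast+
  have axa: "a * x * a = a"
    using is_core_inverse_imp_one_three[OF assms] unfolding is_one_three_inverse_def by blast
  have "x * a * x = x * a * (a * (x * x))" by (simp only: x(1))
  also have "\<dots> = (x * (a * a)) * (x * x)" by (simp only: mult.assoc)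
  finally have xax: "x * a * x = x" by (simp only: x)
  have ag: "a * (x\<^sup>2 * a) = x * a"
    unfolding power2_eq_square using x(1) by (simp only: flip: mult.assoc)
  have ga: "x\<^sup>2 * a * a = x * a"
    unfolding power2_eq_square using x(2) by (simp only: mult.assoc)
  have "x\<^sup>2 * a * a * (x\<^sup>2 * a) = x * a * (x\<^sup>2 * a)" by (simp only: ga)
  also have "\<dots> = (x * a * x) * x * a" by (simp only: power2_eq_square mult.assoc)
  finally have gag: "x\<^sup>2 * a * a * (x\<^sup>2 * a) = x\<^sup>2 * a" by (simp only: xax power2_eq_square)
  have "a\<^sup>2 * (x\<^sup>2 * a) = a * (a * (x\<^sup>2 * a))" by (simp only: power2_eq_square mult.assoc)
  also have "\<dots> = a" using axa by (simp only: ag mult.assoc)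
  finally show ?thesis unfolding is_group_inverse_def using ag ga gag by simp
qed

context
  fixes a g y :: "'a::star_monoid"
  assumes group: "is_group_inverse a g"
    and one_three: "is_one_three_inverse a y"
begin

lemma group_one_three_identities:
  shows "g * a * a = a" "a * g * a = a" "a * y * g = g"
proof -
  have g: "a * g = g * a" "g * a * g = g" "a = a * a * g"
    using group unfolding is_group_inverse_def power2_eq_square by blast+
  have aya: "a * y * a = a"
    using one_three unfolding is_one_three_inverse_def by blast
  have "a * g * a = a * (a * g)" unfolding mult.assoc by (simp only: g(1))
  then show aga: "a * g * a = a" using g(3) by (simp only: mult.assoc)
  then show "g * a * a = a" by (simp only: g(1))
  \<comment> \<open>Commutation turns \<open>g * a * g = g\<close> into
    \<open>g = a * g * g\<close>, and \<open>a * y\<close> fixes every element with left factor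
    \<open>a\<close>.\<close>
  have "a * y * g = a * y * (a * g * g)" using g(1,2) by simp
  also have "\<dots> = (a * y * a) * g * g" by (simp only: mult.assoc)
  finally show "a * y * g = g" using g(1,2) aya by simp
qed

text \<open>Since \<open>a * g * a = a\<close>, the product of \<open>a\<close> with the candidate
  is \<open>a * y\<close>, whose symmetry is given.\<close>

lemma is_core_inverse_group_one_three: "is_core_inverse a (g * a * y)"
proof -
  note i = group_one_three_identities
  have y: "a * y * a = a" "(a * y)\<^sup>\<star> = a * y"
    using one_three unfolding is_one_three_inverse_def by blast+
  have ac: "a * (g * a * y) = a * y" using i(2) by (simp only: flip: mult.assoc)
  have "a * (g * a * y)\<^sup>2 = a * (g * a * y) * (g * a * y)"
    by (simp only: power2_eq_square mult.assoc)
  also have "\<dots> = (a * y * g) * a * y" unfolding ac by (simp only: mult.assoc)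
  finally have 1: "a * (g * a * y)\<^sup>2 = g * a * y" by (simp only: i(3))
  have "g * a * y * a\<^sup>2 = g * (a * y * a) * a" by (simp only: power2_eq_square mult.assoc)
  then have "g * a * y * a\<^sup>2 = a" by (simp only: y(1) i(1))
  with 1 show ?thesis unfolding is_core_inverse_def by (simp only: ac y(2))
qed

text \<open>The extra factor \<open>g\<close> absorbs the extra \<open>a\<close>, so the relevant
  projection is again \<open>a * y\<close>.\<close>

lemma is_w_core_inverse_group_one_three: "is_w_core_inverse a a (g * (g * a * y))"
proof -
  note i = group_one_three_identities
  have g: "a * g = g * a" "a * a * g = a"
    using group unfolding is_group_inverse_def power2_eq_square by auto
  have y: "a * y * a = a" "(a * y)\<^sup>\<star> = a * y"
    using one_three unfolding is_one_three_inverse_def by blast+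
  have "a * a * (g * (g * a * y)) = (a * a * g) * g * a * y" by (simp only: mult.assoc)
  then have aaz: "a * a * (g * (g * a * y)) = a * y" by (simp only: g(2) i(2))
  have "a * a * (g * (g * a * y))\<^sup>2 = a * a * (g * (g * a * y)) * (g * (g * a * y))"
    by (simp only: power2_eq_square mult.assoc)
  also have "\<dots> = (a * y * g) * (g * a * y)" unfolding aaz by (simp only: mult.assoc)
  finally have 1: "a * a * (g * (g * a * y))\<^sup>2 = g * (g * a * y)" by (simp only: i(3))
  have "g * (g * a * y) * a * a * a = g * (g * (a * y * a) * a) * a" by (simp only: mult.assoc)
  then have "g * (g * a * y) * a * a * a = a" by (simp only: y(1) i(1))
  with 1 show ?thesis unfolding is_w_core_inverse_def by (simp only: aaz y(2))
qed

end

lemma is_core_inverse_of_w_core: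
  assumes "is_w_core_inverse a a z"
  shows "is_core_inverse a (a * z)"
proof -
  have z: "a * a * z\<^sup>2 = z" "z * a * a * a = a" "(a * a * z)\<^sup>\<star> = a * a * z"
    using assms unfolding is_w_core_inverse_def by blast+
  have "a * a * z * a = a * a * z * (z * a * a * a)" by (simp only: z(2))
  also have "\<dots> = (a * a * z\<^sup>2) * a * a * a" by (simp only: power2_eq_square mult.assoc)
  finally have aaza: "a * a * z * a = a" by (simp only: z)
  \<comment> \<open>Expanding the leading \<open>a\<close> creates the block
    \<open>a * a * z * a\<close>, which \<open>aaza\<close> reduces to \<open>a\<close>; this forces
    commutation.\<close>
  have "a * (z * a) = (z * a * a * a) * (z * a)" by (simp only: z(2))
  also have "\<dots> = z * a * (a * a * z * a)" by (simp only: mult.assoc)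
  finally have comm: "a * (z * a) = z * a * a" by (simp only: aaza)
  have "a * (a * z)\<^sup>2 = (a * a * z * a) * z" by (simp only: power2_eq_square mult.assoc)
  then have 1: "a * (a * z)\<^sup>2 = a * z" by (simp only: aaza)
  have "a * z * a\<^sup>2 = (a * (z * a)) * a" by (simp only: power2_eq_square mult.assoc)
  then have "a * z * a\<^sup>2 = a" by (simp only: comm z(2))
  with 1 z(3) show ?thesis unfolding is_core_inverse_def by (simp only: mult.assoc)
qed

lemma core_inverse_eq: "is_core_inverse a x \<Longrightarrow> core_inverse a = x"
  unfolding core_inverse_def by (blast intro: the_equality is_core_inverse_unique)

lemma w_core_inverse_eq: "is_w_core_inverse w a x \<Longrightarrow> w_core_inverse w a = x"
  unfolding w_core_inverse_def by (blast intro: the_equality is_w_core_inverse_unique)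

lemma group_inverse_eq: "is_group_inverse a x \<Longrightarrow> group_inverse a = x"
  unfolding group_inverse_def by (blast intro: the_equality is_group_inverse_unique)

theorem proposition2p15:
  fixes a :: "'a::star_monoid"
  shows "(core_invertible a \<longleftrightarrow> (group_invertible a \<and> (\<exists>x. is_one_three_inverse a x))) \<and>
    (core_invertible a \<longleftrightarrow> w_core_invertible a a) \<and>
    (core_invertible a \<longleftrightarrow>
      (\<exists>x. a ^ 2 * x ^ 2 = x \<and> x * a ^ 3 = a \<and> (a ^ 2 * x)\<^sup>\<star> = a ^ 2 * x)) \<and>
    (core_invertible a \<longrightarrow>
      core_inverse a = a * w_core_inverse a a \<and>
      w_core_inverse a a = group_inverse a * core_inverse a)"
proof (intro conjI impI)
  show i_ii: "core_invertible a \<longleftrightarrow> group_invertible a \<and> (\<exists>x. is_one_three_inverse a x)"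
    unfolding core_invertible_def group_invertible_def
    using is_core_inverse_imp_group is_core_inverse_imp_one_three
      is_core_inverse_group_one_three by blast
  \<comment> \<open>The equivalence just shown supplies the pair \<open>g\<close>, \<open>y\<close>
    from which an \<open>a\<close>-core inverse is built.\<close>
  then show i_iii: "core_invertible a \<longleftrightarrow> w_core_invertible a a"
    unfolding core_invertible_def w_core_invertible_def group_invertible_def
    using is_core_inverse_of_w_core is_w_core_inverse_group_one_three by blast
  \<comment> \<open>Conditions (iii) and (iv) differ only in bracketing and power notation.\<close>
  then show "core_invertible a \<longleftrightarrow>
      (\<exists>x. a ^ 2 * x ^ 2 = x \<and> x * a ^ 3 = a \<and> (a ^ 2 * x)\<^sup>\<star> = a ^ 2 * x)"
    unfolding w_core_invertible_def is_w_core_inverse_def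
    by (simp only: power2_eq_square power3_eq_cube mult.assoc)
  assume core: "core_invertible a"
  with i_iii obtain z where z: "is_w_core_inverse a a z"
    unfolding w_core_invertible_def by blast
  then show "core_inverse a = a * w_core_inverse a a"
    by (simp only: w_core_inverse_eq core_inverse_eq[OF is_core_inverse_of_w_core])
  from core i_ii obtain g y where gy: "is_group_inverse a g" "is_one_three_inverse a y"
    unfolding group_invertible_def by blast
  \<comment> \<open>One pair \<open>g\<close>, \<open>y\<close> computes all three inverses, so both
    sides become \<open>g * (g * a * y)\<close>.\<close>
  show "w_core_inverse a a = group_inverse a * core_inverse a"
    unfolding group_inverse_eq[OF gy(1)]
      core_inverse_eq[OF is_core_inverse_group_one_three[OF gy]]
      w_core_inverse_eq[OF is_w_core_inverse_group_one_three[OF gy]] ..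
qed

end
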